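(* Suppose the following assumptions hold. (1) For each $z\in\mathcal Z$, $|c(z,\bar y)-c(z,y)|\le L(z)\|\bar y-y\|$ for all $y,\bar y\in\mathcal Y$, where $\sup_{z\in\mathcal Z}L(z)<+\infty$. (2) For a.e. $x\in\mathcal X$, $\sup_{z\in\mathcal Z}|g_n^*(z;x)-g(z;x)|\xrightarrow{p}0$. (3) $\frac1n\sum_{i=1}^n\|Q^*(x^i)\|^4\xrightarrow{p}\mathbb E[\|Q^*(X)\|^4]$ and $\frac1n\sum_{i=1}^n\|[Q^*(x^i)]^{-1}\|^2\xrightarrow{p}\mathbb E[\|[Q^*(X)]^{-1}\|^2]$ (these expectations being finite). (4) $\frac1n\sum_{i=1}^n\|\varepsilon^i\|^4\xrightarrow{p}\mathbb E[\|\varepsilon\|^4]$ (this expectation being finite). (5) The regression estimates satisfy: (a) $\hat f_n(x)\xrightarrow{p}f^*(x)$ for a.e. $x\in\mathcal X$; (b) $\frac1n\sum_{i=1}^n\|f^*(x^i)-\hat f_n(x^i)\|^2\xrightarrow{p}0$; (c) $\hat Q_n(x)\xrightarrow{p}Q^*(x)$ for a.e. $x\in\mathcal X$; (d) $\frac1n\sum_{i=1}^n\|[\hat Q_n(x^i)]^{-1}-[Q^*(x^i)]^{-1}\|^2\xrightarrow{p}0$. Then, for a.e. $x\in\mathcal X$, $$\hat v_n^{ER}(x)\xrightarrow{p}v^*(x),\qquad \mathbb D\bigl(\hat S_n^{ER}(x),S^*(x)\bigr)\xrightarrow{p}0,\qquad \sup_{z\in\hat S_n^{ER}(x)}g(z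;x)\xrightarrow{p}v^*(x).$$
   Context: Setting. $X$ is a random vector of covariates with distribution $P_X$ and support $\mathcal X\subseteq\mathbb R^{d_x}$; $Y$ is a random vector with (closed) support $\mathcal Y\subseteq\mathbb R^{d_y}$, which is assumed nonempty and convex. $\mathcal Z\subset\mathbb R^{d_z}$ is nonempty and compact and $c:\mathcal Z\times\mathcal Y\to\mathbb R$. It is assumed that $Y=f^*(X)+Q^*(X)\varepsilon$, where $f^*(x)=\mathbb E[Y\mid X=x]$, $Q^*(\bar x)\in\mathbb R^{d_y\times d_y}$ is positive definite for all $\bar x\in\mathcal X$, and $\varepsilon$ is a zero-mean random vector independent of $X$ with distribution $P_\varepsilon$ and support $\Xi\subseteq\mathbb R^{d_y}$. True problem: $v^*(x):=\min_{z\in\mathcal Z}\{g(z;x):=\mathbb E[c(z,f^*(x)+Q^*(x)\varepsilon)]\}$ (expectation over $\varepsilon\sim P_\varepsilon$), with optimal solution set $S^*(x)$. It is assumed that $\mathbb E[|c(z,f^*(x)+Q^*(x)\varepsilon)|]<+\infty$ for each $z\in\mathcal Z$ and a.e. $x\in\mathcal X$, and that $g(\cdot;x)$ is lower semicontinuous on $\mathcal Z$ for a.e. $x\in\mathcal X$. Data: $\mathcal D_n=\{(y^i,x^i)\}_{i=1}^n$ are joint observations of $(Y,X)$ (not assumed i.i.d. unless stated), and $\varepsilon^i:=[Q^*(x^i)]^{-1}(y^i-f^*(x^i))$ are the corresponding error realizations. Full-information SAA objective: $g_n^*(z;x):=\frac1n\sum_{i=1}^n c(z,f^*(x)+Q^*(x)\varepsilon^i)$;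 for a.e. $x$, the points $f^*(x)+Q^*(x)\varepsilon^i$ lie in $\mathcal Y$ almost surely. Estimates: $\hat f_n:\mathcal X\to\mathbb R^{d_y}$ and $\hat Q_n:\mathcal X\to\mathbb R^{d_y\times d_y}$ (with $\hat Q_n(\bar x)$ nonsingular for all $\bar x\in\mathcal X$) are estimates of $f^*$ and $Q^*$ computed from $\mathcal D_n$. Empirical residuals: $\hat\varepsilon_n^i:=[\hat Q_n(x^i)]^{-1}(y^i-\hat f_n(x^i))$. With $\operatorname{proj}_{\mathcal Y}$ the orthogonal projection onto $\mathcal Y$, the empirical-residuals SAA (ER-SAA) problem is $$\hat v_n^{ER}(x):=\min_{z\in\mathcal Z}\Bigl\{\hat g_n^{ER}(z;x):=\frac1n\sum_{i=1}^n c\bigl(z,\operatorname{proj}_{\mathcal Y}(\hat f_n(x)+\hat Q_n(x)\hat\varepsilon_n^i)\bigr)\Bigr\},$$ with optimal solution set $\hat S_n^{ER}(x)$, assumed nonempty for a.e. $x\in\mathcal X$. Conventions: $\|\cdot\|$ is the Euclidean norm or its induced matrix norm; "a.e. $x\in\mathcal X$" is with respect to $P_X$; probabilities and $\xrightarrow{p}$ (convergence in probability as $n\to\infty$) refer to the measure generating the data; all functions, sets and selections are assumed measurable. For $A,B\subseteq\mathbb R^{d_z}$, $\mathbb D(A,B):=\sup_{v\in A}\operatorname{dist}(v,B)$ with $\operatorname{dist}(v,B):=\inf_{w\in B}\|v-w\|$. *)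

theory Defs
  imports "HOL-Probability.Probability"
begin

text \<open>The closed support of a Borel measure.\<close>

definition measure_support :: "'a::topological_space measure \<Rightarrow> 'a set" where
  "measure_support \<mu> = {x. \<forall>U. open U \<longrightarrow> x \<in> U \<longrightarrow> emeasure \<mu> U > 0}"

text \<open>The library norm on \<open>real^'n^'m\<close> is the Frobenius norm; this is the norm induced by
  the Euclidean norm.\<close>

definition mat_norm :: "real^'n^'m \<Rightarrow> real" where
  "mat_norm A = onorm (\<lambda>v. A *v v)"

text \<open>Symmetry is not part of this definition.\<close>

definition pos_definite :: "real^'n^'n \<Rightarrow> bool" where
  "pos_definite A \<longleftrightarrow> (\<forall>v. v \<noteq> 0 \<longrightarrow> 0 < v \<bullet> (A *v v))"

definition lsc_on :: "'a::topological_space set \<Rightarrow> ('a \<Rightarrow> real) \<Rightarrow> bool" where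
  "lsc_on Z h \<longleftrightarrow> (\<forall>z\<in>Z. ereal (h z) \<le> Liminf (at z within Z) (\<lambda>w. ereal (h w)))"

text \<open>Convergence in probability is a statement about random variables, so measurability of
  each term is included.  The \<open>ereal\<close> version is for suprema, which may be infinite.\<close>

definition tendsto_prob ::
    "'w measure \<Rightarrow> (nat \<Rightarrow> 'w \<Rightarrow> 'a::{metric_space, second_countable_topology}) \<Rightarrow> 'a \<Rightarrow> bool" where
  "tendsto_prob M V c \<longleftrightarrow>
     (\<forall>n. V n \<in> borel_measurable M) \<and>
     (\<forall>e>0. (\<lambda>n. measure M {\<omega> \<in> space M. dist (V n \<omega>) c > e}) \<longlonglongrightarrow> 0)"

definition tendsto_prob_ereal ::
    "'w measure \<Rightarrow> (nat \<Rightarrow> 'w \<Rightarrow> ereal) \<Rightarrow> real \<Rightarrow> bool" where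
  "tendsto_prob_ereal M V c \<longleftrightarrow>
     (\<forall>n. V n \<in> borel_measurable M) \<and>
     (\<forall>e::real. e > 0 \<longrightarrow>
        (\<lambda>n. measure M {\<omega> \<in> space M. \<bar>V n \<omega> - ereal c\<bar> > ereal e}) \<longlonglongrightarrow> 0)"

definition opt_value :: "'z set \<Rightarrow> ('z \<Rightarrow> real) \<Rightarrow> real" where
  "opt_value Z h = (INF z\<in>Z. h z)"

definition opt_set :: "'z set \<Rightarrow> ('z \<Rightarrow> real) \<Rightarrow> 'z set" where
  "opt_set Z h = {z \<in> Z. \<forall>w\<in>Z. h z \<le> h w}"

definition set_deviation :: "'a::metric_space set \<Rightarrow> 'a set \<Rightarrow> ereal" where
  "set_deviation A B = (SUP v\<in>A. INF w\<in>B. ereal (dist v w))"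

text \<open>A data set is a function \<open>D\<close> on \<open>{1..n}\<close> with \<open>D i = (y\<^sup>i, x\<^sup>i)\<close>.\<close>

type_synonym ('dy, 'dx) dataset = "nat \<Rightarrow> (real^'dy) \<times> (real^'dx)"

definition sample ::
    "(nat \<Rightarrow> 'w \<Rightarrow> real^'dy) \<Rightarrow> (nat \<Rightarrow> 'w \<Rightarrow> real^'dx) \<Rightarrow> nat \<Rightarrow> 'w \<Rightarrow> ('dy, 'dx) dataset" where
  "sample ys xs n \<omega> = (\<lambda>i\<in>{1..n}. (ys i \<omega>, xs i \<omega>))"

text \<open>With the true pair \<open>(f\<^sup>*, Q\<^sup>*)\<close> this is the error realization of an observation, with an
  estimated pair it is the empirical residual.\<close>

definition residual ::
    "(real^'dx \<Rightarrow> real^'dy) \<Rightarrow> (real^'dx \<Rightarrow> real^'dy^'dy) \<Rightarrow> (real^'dy) \<times> (real^'dx) \<Rightarrow> real^'dy" where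
  "residual f Q = (\<lambda>(y, x). matrix_inv (Q x) *v (y - f x))"

definition true_obj ::
    "'v measure \<Rightarrow> ('v \<Rightarrow> real^'dy) \<Rightarrow> ('z \<Rightarrow> real^'dy \<Rightarrow> real) \<Rightarrow>
     (real^'dx \<Rightarrow> real^'dy) \<Rightarrow> (real^'dx \<Rightarrow> real^'dy^'dy) \<Rightarrow> real^'dx \<Rightarrow> 'z \<Rightarrow> real" where
  "true_obj N \<epsilon> c f Q x z = (\<integral>\<omega>. c z (f x + Q x *v \<epsilon> \<omega>) \<partial>N)"

definition full_saa_obj ::
    "('z \<Rightarrow> real^'dy \<Rightarrow> real) \<Rightarrow> (real^'dx \<Rightarrow> real^'dy) \<Rightarrow> (real^'dx \<Rightarrow> real^'dy^'dy) \<Rightarrow>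
     nat \<Rightarrow> ('dy, 'dx) dataset \<Rightarrow> real^'dx \<Rightarrow> 'z \<Rightarrow> real" where
  "full_saa_obj c f Q n D x z = (1 / real n) * (\<Sum>i=1..n. c z (f x + Q x *v residual f Q (D i)))"

text \<open>Here \<open>fh\<close> and \<open>Qh\<close> are estimators, that is, they map a data set to an estimate.\<close>

definition er_saa_obj ::
    "('z \<Rightarrow> real^'dy \<Rightarrow> real) \<Rightarrow> (real^'dy) set \<Rightarrow>
     (nat \<Rightarrow> ('dy, 'dx) dataset \<Rightarrow> real^'dx \<Rightarrow> real^'dy) \<Rightarrow>
     (nat \<Rightarrow> ('dy, 'dx) dataset \<Rightarrow> real^'dx \<Rightarrow> real^'dy^'dy) \<Rightarrow>
     nat \<Rightarrow> ('dy, 'dx) dataset \<Rightarrow> real^'dx \<Rightarrow> 'z \<Rightarrow> real" where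
  "er_saa_obj c Y fh Qh n D x z =
     (1 / real n) * (\<Sum>i=1..n.
        c z (closest_point Y (fh n D x + Qh n D x *v residual (fh n D) (Qh n D) (D i))))"

end

theory Submission
  imports Defs
begin

text \<open>
  Fix a covariate value \<open>x\<close> outside the exceptional null sets. All three conclusions are
  deterministic consequences of one fact: the ER-SAA objective is uniformly close to the true
  objective on \<open>\<Z>\<close>, with probability tending to one.

  The full-information SAA objective is uniformly close to the true one by hypothesis, so only the
  two sample averages have to be compared. Projecting onto \<open>\<Y>\<close> does not increase the
  distance to a point of \<open>\<Y>\<close>, and \<open>c z\<close> is Lipschitz on \<open>\<Y>\<close> with a constant
  that is uniform in \<open>z\<close>. Hence the gap between the objectives is at most a constant times the mean
  distance between the estimated scenarios
  \<open>f\<^sub>n(x) + Q\<^sub>n(x) \<epsilon>\<^sub>n\<^sup>i\<close> and the true ones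
  \<open>f(x) + Q(x) \<epsilon>\<^sup>i\<close> (\<open>er_saa_obj_near_full_saa_obj\<close>). Write
  \<open>a\<^sub>i\<close> and \<open>b\<^sub>i\<close> for the estimation errors of \<open>Q\<^sup>-\<^sup>1\<close> and
  \<open>f\<close> at the \<open>i\<close>th data point, and \<open>q\<^sub>i, r\<^sub>i, e\<^sub>i\<close> for the norms of
  \<open>Q\<close>, \<open>Q\<^sup>-\<^sup>1\<close> and the error there. The residual error is then at most
  \<open>a\<^sub>i b\<^sub>i + a\<^sub>i q\<^sub>i e\<^sub>i + r\<^sub>i b\<^sub>i\<close> (\<open>residual_error_le\<close>).
  Each product contains a factor that is small in quadratic mean, and the other factors have bounded
  second or fourth empirical moments, so the mean is small (\<open>average_prediction_error_le\<close>).

  Passing from uniformly close objectives to close optimal values and near-optimal solutions uses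
  that a lower semicontinuous function on a compact set cannot come arbitrarily close to its minimum
  away from its minimizers (\<open>minimization_stable\<close>).
\<close>

section \<open>Events whose probability tends to one\<close>

text \<open>
  The event \<open>P n\<close> need not be measurable; it is only required to hold outside measurable sets of
  vanishing probability. This matters below, where \<open>P n\<close> quantifies over the uncountably many
  decisions in \<open>\<Z>\<close>. Exceptional null sets are absorbed as well.
\<close>

definition whp :: "'w measure \<Rightarrow> (nat \<Rightarrow> 'w \<Rightarrow> bool) \<Rightarrow> bool" where
  "whp M P \<longleftrightarrow> (\<exists>B. (\<forall>n. B n \<in> sets M) \<and> (\<lambda>n. measure M (B n)) \<longlonglongrightarrow> 0 \<and>
     (\<forall>\<^sub>F n in sequentially. AE \<omega> in M. \<omega> \<notin> B n \<longrightarrow> P n \<omega>))"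

lemma whp_if_eventually_AE: "\<forall>\<^sub>F n in sequentially. AE \<omega> in M. P n \<omega> \<Longrightarrow> whp M P"
  unfolding whp_def by (rule exI[of _ "\<lambda>_. {}"]) simp

lemma whp_conj:
  assumes M: "prob_space M" and "whp M P" "whp M R"
  shows "whp M (\<lambda>n \<omega>. P n \<omega> \<and> R n \<omega>)"
proof -
  interpret prob_space M by fact
  obtain B where B: "\<And>n. B n \<in> sets M" "(\<lambda>n. measure M (B n)) \<longlonglongrightarrow> 0"
    "\<forall>\<^sub>F n in sequentially. AE \<omega> in M. \<omega> \<notin> B n \<longrightarrow> P n \<omega>"
    using assms(2) unfolding whp_def by blast
  obtain C where C: "\<And>n. C n \<in> sets M" "(\<lambda>n. measure M (C n)) \<longlonglongrightarrow> 0"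
    "\<forall>\<^sub>F n in sequentially. AE \<omega> in M. \<omega> \<notin> C n \<longrightarrow> R n \<omega>"
    using assms(3) unfolding whp_def by blast
  have "(\<lambda>n. measure M (B n \<union> C n)) \<longlonglongrightarrow> 0"
  proof (rule tendsto_sandwich[OF _ _ tendsto_const])
    show "\<forall>\<^sub>F n in sequentially. measure M (B n \<union> C n) \<le> measure M (B n) + measure M (C n)"
      using B(1) C(1) by (intro always_eventually allI measure_Un_le) auto
    show "(\<lambda>n. measure M (B n) + measure M (C n)) \<longlonglongrightarrow> 0"
      using tendsto_add[OF B(2) C(2)] by simp
  qed simp
  moreover have "\<forall>\<^sub>F n in sequentially. AE \<omega> in M. \<omega> \<notin> B n \<union> C n \<longrightarrow> P n \<omega> \<and> R n \<omega>"
    using B(3) C(3)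
  proof eventually_elim
    case (elim n)
    show ?case using elim by eventually_elim auto
  qed
  ultimately show ?thesis
    unfolding whp_def using B(1) C(1) by (intro exI[of _ "\<lambda>n. B n \<union> C n"]) auto
qed

lemma whp_mono:
  assumes "whp M P" "\<forall>\<^sub>F n in sequentially. AE \<omega> in M. P n \<omega> \<longrightarrow> R n \<omega>"
  shows "whp M R"
proof -
  obtain B where B: "\<And>n. B n \<in> sets M" "(\<lambda>n. measure M (B n)) \<longlonglongrightarrow> 0"
    "\<forall>\<^sub>F n in sequentially. AE \<omega> in M. \<omega> \<notin> B n \<longrightarrow> P n \<omega>"
    using assms(1) unfolding whp_def by blast
  have "\<forall>\<^sub>F n in sequentially. AE \<omega> in M. \<omega> \<notin> B n \<longrightarrow> R n \<omega>"
    using B(3) assms(2)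
  proof eventually_elim
    case (elim n)
    show ?case using elim by eventually_elim auto
  qed
  then show ?thesis unfolding whp_def using B by blast
qed

lemma prob_tendsto_zero_if_whp:
  assumes M: "prob_space M" and "whp M (\<lambda>n \<omega>. \<not> E n \<omega>)"
  shows "(\<lambda>n. measure M {\<omega> \<in> space M. E n \<omega>}) \<longlonglongrightarrow> 0"
proof -
  interpret prob_space M by fact
  obtain B where B: "\<And>n. B n \<in> sets M" "(\<lambda>n. measure M (B n)) \<longlonglongrightarrow> 0"
    "\<forall>\<^sub>F n in sequentially. AE \<omega> in M. \<omega> \<notin> B n \<longrightarrow> \<not> E n \<omega>"
    using assms(2) unfolding whp_def by blast
  show ?thesis
  proof (rule tendsto_sandwich[OF _ _ tendsto_const B(2)])
    show "\<forall>\<^sub>F n in sequentially. measure M {\<omega> \<in> space M. E n \<omega>} \<le> measure M (B n)"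
      using B(3)
    proof eventually_elim
      case (elim n)
      show ?case by (rule finite_measure_mono_AE[OF _ B(1)]) (use elim in auto)
    qed
  qed simp
qed

lemma whp_if_prob_tendsto_zero:
  assumes "\<And>n. {\<omega> \<in> space M. E n \<omega>} \<in> sets M"
    "(\<lambda>n. measure M {\<omega> \<in> space M. E n \<omega>}) \<longlonglongrightarrow> 0"
  shows "whp M (\<lambda>n \<omega>. \<not> E n \<omega>)"
  unfolding whp_def
proof (intro exI conjI allI)
  show "\<forall>\<^sub>F n in sequentially. AE \<omega> in M. \<omega> \<notin> {\<omega> \<in> space M. E n \<omega>} \<longrightarrow> \<not> E n \<omega>"
    by (intro always_eventually allI AE_I2) blast
qed fact+

text \<open>
  These two equivalences turn convergence in probability into a finite number of inequalities that
  hold simultaneously on one event, so that the estimates themselves can be deterministic.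
\<close>

lemma tendsto_prob_iff_whp:
  assumes M: "prob_space M"
  shows "tendsto_prob M V c \<longleftrightarrow>
    (\<forall>n. V n \<in> borel_measurable M) \<and> (\<forall>e>0. whp M (\<lambda>n \<omega>. dist (V n \<omega>) c \<le> e))"
    (is "?conv \<longleftrightarrow> ?meas \<and> ?near")
proof (intro iffI conjI)
  assume conv: ?conv
  then show V: ?meas unfolding tendsto_prob_def by (rule conjunct1)
  show ?near
  proof (intro allI impI)
    fix e :: real assume "e > 0"
    have "{\<omega> \<in> space M. dist (V n \<omega>) c > e} \<in> sets M" for n
      using V[rule_format, of n] by measurable
    then show "whp M (\<lambda>n \<omega>. dist (V n \<omega>) c \<le> e)"
      using conv \<open>e > 0\<close> whp_if_prob_tendsto_zero[of M "\<lambda>n \<omega>. dist (V n \<omega>) c > e"]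
      unfolding tendsto_prob_def not_less by blast
  qed
next
  assume R: "?meas \<and> ?near"
  show ?conv
    unfolding tendsto_prob_def
  proof (intro conjI allI impI)
    fix e :: real assume "e > 0"
    with R show "(\<lambda>n. measure M {\<omega> \<in> space M. dist (V n \<omega>) c > e}) \<longlonglongrightarrow> 0"
      by (intro prob_tendsto_zero_if_whp[OF M]) (simp only: not_less)
  qed (use R in blast)
qed

lemma tendsto_prob_ereal_iff_whp:
  assumes M: "prob_space M"
  shows "tendsto_prob_ereal M V c \<longleftrightarrow>
    (\<forall>n. V n \<in> borel_measurable M) \<and> (\<forall>e>0. whp M (\<lambda>n \<omega>. \<bar>V n \<omega> - ereal c\<bar> \<le> ereal e))"
    (is "?conv \<longleftrightarrow> ?meas \<and> ?near")
proof (intro iffI conjI)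
  assume conv: ?conv
  then show V: ?meas unfolding tendsto_prob_ereal_def by (rule conjunct1)
  show ?near
  proof (intro allI impI)
    fix e :: real assume "e > 0"
    have eq: "\<bar>s - ereal c\<bar> > ereal e \<longleftrightarrow> s > ereal (c + e) \<or> s < ereal (c - e)" for s
      using \<open>e > 0\<close> by (cases s) auto
    have "{\<omega> \<in> space M. \<bar>V n \<omega> - ereal c\<bar> > ereal e} \<in> sets M" for n
      \<comment> \<open>Two one-sided conditions avoid measurability of subtraction and absolute value on
        extended reals.\<close>
      unfolding eq using V[rule_format, of n] by measurable
    then show "whp M (\<lambda>n \<omega>. \<bar>V n \<omega> - ereal c\<bar> \<le> ereal e)"
      using conv \<open>e > 0\<close> whp_if_prob_tendsto_zero[of M "\<lambda>n \<omega>. \<bar>V n \<omega> - ereal c\<bar> > ereal e"]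
      unfolding tendsto_prob_ereal_def not_less by blast
  qed
next
  assume R: "?meas \<and> ?near"
  show ?conv
    unfolding tendsto_prob_ereal_def
  proof (intro conjI allI impI)
    fix e :: real assume "e > 0"
    with R show "(\<lambda>n. measure M {\<omega> \<in> space M. \<bar>V n \<omega> - ereal c\<bar> > ereal e}) \<longlonglongrightarrow> 0"
      by (intro prob_tendsto_zero_if_whp[OF M]) (simp only: not_less)
  qed (use R in blast)
qed

section \<open>Stability of minimization under uniform perturbation\<close>

lemma lsc_on_subset:
  assumes "lsc_on Z h" "K \<subseteq> Z"
  shows "lsc_on K h"
  unfolding lsc_on_def
proof (intro ballI)
  fix z assume "z \<in> K"
  then have "ereal (h z) \<le> Liminf (at z within Z) (\<lambda>w. ereal (h w))"
    using assms by (auto simp: lsc_on_def)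
  then show "ereal (h z) \<le> Liminf (at z within K) (\<lambda>w. ereal (h w))"
    using filter_leD[OF at_le[OF assms(2)]] unfolding le_Liminf_iff by blast
qed

text \<open>
  If no minimum is attained, every \<open>z\<close> is beaten by some \<open>b z\<close>, and by lower semicontinuity
  \<open>b z\<close> beats a whole neighbourhood of \<open>z\<close>. Among the finitely many \<open>b z\<close> whose
  neighbourhoods cover \<open>K\<close>, the best one lies in some neighbourhood and is itself beaten by
  another: a contradiction.
\<close>

lemma lsc_on_compact_attains_min:
  assumes "compact K" "K \<noteq> {}" "lsc_on K h"
  shows "opt_set K h \<noteq> {}"
proof
  assume "opt_set K h = {}"
  then have "\<forall>z\<in>K. \<exists>w\<in>K. h w < h z"
    by (auto simp: opt_set_def not_le)
  then obtain b where b: "\<And>z. z \<in> K \<Longrightarrow> b z \<in> K \<and> h (b z) < h z"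
    by metis
  have "\<exists>S. open S \<and> z \<in> S \<and> (\<forall>u\<in>S \<inter> K. h (b z) < h u)" if z: "z \<in> K" for z
  proof -
    have "ereal (h z) \<le> Liminf (at z within K) (\<lambda>w. ereal (h w))"
      using assms(3) z by (auto simp: lsc_on_def)
    then have "\<forall>\<^sub>F u in at z within K. ereal (h (b z)) < ereal (h u)"
      unfolding le_Liminf_iff by (elim allE[of _ "ereal (h (b z))"]) (use b[OF z] in simp)
    then obtain S where "open S" "z \<in> S" "\<forall>u\<in>S. u \<noteq> z \<longrightarrow> u \<in> K \<longrightarrow> h (b z) < h u"
      by (auto simp: eventually_at_topological)
    then show ?thesis using b[OF z] by (intro exI[of _ S]) auto
  qed
  then obtain S where S: "\<And>z. z \<in> K \<Longrightarrow> open (S z)" "\<And>z. z \<in> K \<Longrightarrow> z \<in> S z"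
    "\<And>z u. z \<in> K \<Longrightarrow> u \<in> S z \<Longrightarrow> u \<in> K \<Longrightarrow> h (b z) < h u"
    by (metis IntI)
  have "K \<subseteq> (\<Union>z\<in>K. S z)" using S(2) by auto
  with S(1) obtain F where F: "F \<subseteq> K" "finite F" "K \<subseteq> (\<Union>z\<in>F. S z)"
    by (rule compactE_image[OF assms(1)])
  have "F \<noteq> {}" using F(3) assms(2) by auto
  then obtain z0 where z0: "z0 \<in> F" "\<And>z. z \<in> F \<Longrightarrow> h (b z0) \<le> h (b z)"
    using arg_min_if_finite(1)[OF F(2)] arg_min_least[OF F(2), where f = "\<lambda>z. h (b z)"] by metis
  then have "b z0 \<in> K" using F(1) b by auto
  then obtain z1 where "z1 \<in> F" "b z0 \<in> S z1" using F(3) by auto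
  then have "h (b z1) < h (b z0)" using S(3) F(1) \<open>b z0 \<in> K\<close> by blast
  then show False using z0(2)[OF \<open>z1 \<in> F\<close>] by simp
qed

lemma opt_value_eq:
  assumes "z \<in> opt_set Z h"
  shows "opt_value Z h = h z"
  using assms unfolding opt_value_def opt_set_def by (intro cInf_eq_minimum) auto

text \<open>
  Removing an open \<open>e\<close>-neighbourhood of the minimizers leaves a compact set. Unless it is empty, the
  minimum over it is attained as well and therefore exceeds the global minimum by a positive gap.
\<close>

lemma near_optimal_points_near_opt_set:
  fixes Z :: "'a::metric_space set"
  assumes "compact Z" "Z \<noteq> {}" "lsc_on Z h" "e > 0"
  obtains d where "d > 0"
    "\<And>z. z \<in> Z \<Longrightarrow> h z \<le> opt_value Z h + d \<Longrightarrow> \<exists>w\<in>opt_set Z h. dist z w < e"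
proof -
  define K where "K = Z - (\<Union>w\<in>opt_set Z h. ball w e)"
  have "compact K" unfolding K_def by (intro compact_diff assms(1)) auto
  have lK: "lsc_on K h" using lsc_on_subset[OF assms(3)] by (auto simp: K_def)
  obtain m where m: "m \<in> opt_set Z h"
    using lsc_on_compact_attains_min[OF assms(1-3)] by auto
  have near: "\<exists>w\<in>opt_set Z h. dist z w < e" if "z \<in> Z" "z \<notin> K" for z
    using that by (auto simp: K_def dist_commute)
  show thesis
  proof (cases "K = {}")
    case True
    then show thesis using near that[of 1] by auto
  next
    case False
    obtain k where k: "k \<in> opt_set K h"
      using lsc_on_compact_attains_min[OF \<open>compact K\<close> False lK] by auto
    then have "k \<in> Z" "k \<notin> opt_set Z h"
      using assms(4) by (auto simp: K_def opt_set_def)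
    then have gap: "h m < h k"
      using m by (force simp: opt_set_def)
    show thesis
    proof (rule that[of "(h k - h m) / 2"])
      fix z assume z: "z \<in> Z" "h z \<le> opt_value Z h + (h k - h m) / 2"
      then have "h z < h k"
        using gap unfolding opt_value_eq[OF m] by argo
      then have "z \<notin> K" using k by (auto simp: opt_set_def)
      then show "\<exists>w\<in>opt_set Z h. dist z w < e" using near z by auto
    qed (use gap in simp)
  qed
qed

lemma ereal_abs_diff_le:
  assumes "ereal a \<le> s" "s \<le> ereal (a + e)"
  shows "\<bar>s - ereal a\<bar> \<le> ereal e"
  using assms by (cases s) auto

lemma ereal_le_if_abs_diff_le: "\<bar>s - ereal a\<bar> \<le> ereal e \<Longrightarrow> s \<le> ereal (a + e)"
  by (cases s) auto

text \<open>
  If \<open>G\<close> is within \<open>d\<close> of \<open>h\<close>, then a minimizer of \<open>G\<close> is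
  \<open>2 * d\<close>-optimal for \<open>h\<close>. Since \<open>d\<close> is chosen before \<open>G\<close>, the lemma
  applies to random objectives, with the same \<open>d\<close> for all sample sizes and outcomes.
\<close>

lemma minimization_stable:
  fixes Z :: "'a::metric_space set"
  assumes "compact Z" "Z \<noteq> {}" "lsc_on Z h" "e > 0"
  obtains d where "d > 0"
    "\<And>G. (\<And>z. z \<in> Z \<Longrightarrow> \<bar>G z - h z\<bar> \<le> d) \<Longrightarrow> opt_set Z G \<noteq> {} \<Longrightarrow>
       dist (opt_value Z G) (opt_value Z h) \<le> e \<and>
       \<bar>set_deviation (opt_set Z G) (opt_set Z h) - ereal 0\<bar> \<le> ereal e \<and>
       \<bar>(SUP z\<in>opt_set Z G. ereal (h z)) - ereal (opt_value Z h)\<bar> \<le> ereal e"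
proof -
  obtain r where r: "r > 0"
    "\<And>z. z \<in> Z \<Longrightarrow> h z \<le> opt_value Z h + r \<Longrightarrow> \<exists>w\<in>opt_set Z h. dist z w < e"
    using near_optimal_points_near_opt_set[OF assms] by blast
  obtain m where m: "m \<in> opt_set Z h"
    using lsc_on_compact_attains_min[OF assms(1-3)] by auto
  define d where "d = min e r / 2"
  have d: "d > 0" "2 * d \<le> e" "2 * d \<le> r" using r(1) assms(4) by (auto simp: d_def)
  show thesis
  proof (rule that[OF d(1)])
    fix G assume G: "\<And>z. z \<in> Z \<Longrightarrow> \<bar>G z - h z\<bar> \<le> d" and ne: "opt_set Z G \<noteq> {}"
    have opt: "h z \<le> h m + 2 * d \<and> h m \<le> h z \<and> \<bar>G z - h m\<bar> \<le> d" if z: "z \<in> opt_set Z G" for z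
    proof -
      have "z \<in> Z" "m \<in> Z" "G z \<le> G m" "h m \<le> h z"
        using z m by (auto simp: opt_set_def)
      then show ?thesis using G[of z] G[of m] by (auto simp: abs_le_iff)
    qed
    obtain z0 where z0: "z0 \<in> opt_set Z G" using ne by auto
    have "dist (opt_value Z G) (opt_value Z h) \<le> e"
      unfolding opt_value_eq[OF m] opt_value_eq[OF z0] dist_real_def
      using opt[OF z0] d by linarith
    moreover have "set_deviation (opt_set Z G) (opt_set Z h) \<le> ereal e"
      unfolding set_deviation_def
    proof (rule SUP_least)
      fix z assume z: "z \<in> opt_set Z G"
      then obtain w where "w \<in> opt_set Z h" "dist z w < e"
        using r(2)[of z] opt[OF z] d unfolding opt_value_eq[OF m] by (auto simp: opt_set_def)
      then show "(INF w\<in>opt_set Z h. ereal (dist z w)) \<le> ereal e"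
        by (intro INF_lower2[of w]) auto
    qed
    moreover have "0 \<le> set_deviation (opt_set Z G) (opt_set Z h)"
      unfolding set_deviation_def by (rule SUP_upper2[OF z0], rule INF_greatest) auto
    moreover have "(SUP z\<in>opt_set Z G. ereal (h z)) \<le> ereal (h m + e)"
      by (rule SUP_least) (use opt d in force)
    moreover have "ereal (h m) \<le> (SUP z\<in>opt_set Z G. ereal (h z))"
      by (rule SUP_upper2[OF z0]) (use opt[OF z0] in simp)
    ultimately show "dist (opt_value Z G) (opt_value Z h) \<le> e \<and>
       \<bar>set_deviation (opt_set Z G) (opt_set Z h) - ereal 0\<bar> \<le> ereal e \<and>
       \<bar>(SUP z\<in>opt_set Z G. ereal (h z)) - ereal (opt_value Z h)\<bar> \<le> ereal e"
      unfolding opt_value_eq[OF m] by (intro conjI ereal_abs_diff_le) (simp_all add: zero_ereal_def)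
  qed
qed

section \<open>Residuals of the estimated and of the true model\<close>

lemma norm_matrix_vector_le: "norm (A *v v) \<le> mat_norm A * norm v"
  for A :: "real^'n^'m"
  unfolding mat_norm_def by (rule onorm) simp

lemma mat_norm_nonneg: "0 \<le> mat_norm A" for A :: "real^'n^'m"
  unfolding mat_norm_def by (rule onorm_pos_le) simp

lemma pos_definite_mult_inv:
  fixes A :: "real^'n^'n"
  assumes "pos_definite A"
  shows "A ** matrix_inv A = mat 1"
proof -
  have "\<forall>v. A *v v = 0 \<longrightarrow> v = 0"
    using assms unfolding pos_definite_def by (metis inner_zero_right less_irrefl)
  then have "invertible A"
    using matrix_left_invertible_ker[of A] invertible_left_inverse by blast
  then have "A ** matrix_inv A = mat 1 \<and> matrix_inv A ** A = mat 1"
    unfolding matrix_inv_def invertible_def by (rule someI_ex)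
  then show ?thesis by simp
qed

text \<open>
  Write \<open>A\<close> for the difference of the two inverse matrices, \<open>b = f x - f' x\<close>, and
  \<open>u\<close> for the residual of the true model. The identity behind the bound is that the residuals
  differ by \<open>A b + A Q u + Q\<^sup>-\<^sup>1 b\<close>. Invertibility of \<open>Q x\<close> is what makes
  \<open>Q u\<close> recover \<open>y - f x\<close>.
\<close>

lemma residual_error_le:
  assumes "pos_definite (Q x)"
  shows "norm (residual f' Q' (y, x) - residual f Q (y, x)) \<le>
    mat_norm (matrix_inv (Q' x) - matrix_inv (Q x)) * norm (f x - f' x) +
    mat_norm (matrix_inv (Q' x) - matrix_inv (Q x)) * mat_norm (Q x) * norm (residual f Q (y, x)) +
    mat_norm (matrix_inv (Q x)) * norm (f x - f' x)"
proof -
  let ?A = "matrix_inv (Q' x) - matrix_inv (Q x)"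
  let ?b = "f x - f' x"
  let ?\<epsilon> = "residual f Q (y, x)"
  have "Q x *v ?\<epsilon> = y - f x"
    by (simp add: residual_def matrix_vector_mul_assoc pos_definite_mult_inv[OF assms])
  then have "y - f' x = ?b + Q x *v ?\<epsilon>"
    by simp
  then have "residual f' Q' (y, x) = matrix_inv (Q' x) *v (?b + Q x *v ?\<epsilon>)"
    by (simp only: residual_def prod.case)
  moreover have "?\<epsilon> = matrix_inv (Q x) *v (Q x *v ?\<epsilon>)"
    using \<open>Q x *v ?\<epsilon> = y - f x\<close> by (simp add: residual_def)
  ultimately have "residual f' Q' (y, x) - ?\<epsilon> =
      ?A *v ?b + ?A *v (Q x *v ?\<epsilon>) + matrix_inv (Q x) *v ?b"
    by (simp add: algebra_simps matrix_vector_mult_diff_rdistrib matrix_vector_right_distrib)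
  moreover have "norm (?A *v (Q x *v ?\<epsilon>)) \<le> mat_norm ?A * mat_norm (Q x) * norm ?\<epsilon>"
    using order_trans[OF norm_matrix_vector_le
        mult_left_mono[OF norm_matrix_vector_le mat_norm_nonneg]]
    by (simp add: mult.assoc)
  ultimately show ?thesis
    by (simp only: norm_triangle_mono norm_matrix_vector_le)
qed

lemma prediction_error_le:
  fixes Q Q' :: "real^'n^'m"
  shows "norm ((f' + Q' *v u') - (f + Q *v u)) \<le>
    norm (f' - f) + mat_norm (Q' - Q) * norm u + (mat_norm (Q' - Q) + mat_norm Q) * norm (u' - u)"
proof -
  have "(f' + Q' *v u') - (f + Q *v u) =
      (f' - f) + (Q' - Q) *v u + ((Q' - Q) *v (u' - u) + Q *v (u' - u))"
    by (simp add: algebra_simps matrix_vector_mult_diff_rdistrib matrix_vector_mult_diff_distrib)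
  then show ?thesis
    by (simp only: distrib_right norm_triangle_mono norm_matrix_vector_le order_refl)
qed

lemma young_scaled:
  fixes s t d :: real
  assumes "d > 0"
  shows "s * t \<le> s\<^sup>2 / (2 * d) + d * t\<^sup>2 / 2"
proof -
  have "0 \<le> (s - d * t)\<^sup>2 / (2 * d)" using assms by simp
  then show ?thesis using assms by (simp add: field_simps power2_eq_square)
qed

text \<open>
  When \<open>a\<close> and \<open>b\<close> are of order \<open>d\<close> in quadratic mean and the moments of
  \<open>q\<close>, \<open>e\<close> and \<open>r\<close> stay bounded, every term on the right is, for small \<open>d\<close>, at
  most of order \<open>d\<close> on average. Applying Young's inequality to each data point makes the bound linear in the empirical
  moments, and so replaces the Cauchy-Schwarz inequality for the averages.
\<close>

lemma residual_error_young:
  fixes a b q e r d :: real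
  assumes "0 < d" "0 \<le> a" "0 \<le> b"
  shows "a * b + a * q * e + r * b \<le>
    (a\<^sup>2 + b\<^sup>2) / 2 + (a\<^sup>2 + b\<^sup>2) / (2 * d) + d * ((q ^ 4 + e ^ 4) / 4 + r\<^sup>2 / 2)"
proof -
  have "a * b \<le> (a\<^sup>2 + b\<^sup>2) / 2"
    using young_scaled[of 1 a b] by simp
  moreover have "a * (q * e) \<le> a\<^sup>2 / (2 * d) + d * (q * e)\<^sup>2 / 2"
    using young_scaled[OF assms(1)] .
  moreover have "(q * e)\<^sup>2 \<le> (q ^ 4 + e ^ 4) / 2"
    using young_scaled[of 1 "q\<^sup>2" "e\<^sup>2"] by (simp add: power_mult_distrib flip: power_mult)
  then have "d * (q * e)\<^sup>2 / 2 \<le> d * ((q ^ 4 + e ^ 4) / 4)"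
    using assms(1) by simp
  moreover have "b * r \<le> b\<^sup>2 / (2 * d) + d * r\<^sup>2 / 2"
    using young_scaled[OF assms(1)] .
  moreover have "(a\<^sup>2 + b\<^sup>2) / (2 * d) = a\<^sup>2 / (2 * d) + b\<^sup>2 / (2 * d)"
    by (rule add_divide_distrib)
  ultimately show ?thesis
    unfolding distrib_left mult.assoc mult.commute[of r b] by linarith
qed

abbreviation (input) average :: "nat \<Rightarrow> (nat \<Rightarrow> real) \<Rightarrow> real" where
  "average n u \<equiv> (1 / real n) * (\<Sum>i=1..n. u i)"

lemma average_mono: "(\<And>i. i \<in> {1..n} \<Longrightarrow> u i \<le> v i) \<Longrightarrow> average n u \<le> average n v"
  by (intro mult_left_mono sum_mono) auto

lemma average_add: "average n (\<lambda>i. u i + v i) = average n u + average n v"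
  by (simp add: sum.distrib distrib_left add_divide_distrib)

lemma average_cmult: "average n (\<lambda>i. t * u i) = t * average n u"
  by (simp add: sum_distrib_left[symmetric])

lemma average_divide: "average n (\<lambda>i. u i / t) = average n u / t"
  by (simp add: sum_divide_distrib[symmetric])

lemma average_const: "1 \<le> n \<Longrightarrow> average n (\<lambda>i. t) = t"
  by simp

text \<open>
  The hypothesis on \<open>p\<close> is the combination of \<open>prediction_error_le\<close> and
  \<open>residual_error_le\<close>: \<open>F\<close> and \<open>G\<close> are the errors of the two estimators at the new
  covariate, \<open>K\<close> is the norm of \<open>Q\<close> there. The point of the conclusion is that the bound is
  linear in \<open>\<delta>\<close>, with a factor independent of \<open>n\<close> and of the data, so that a small
  \<open>\<delta>\<close> makes the mean error as small as desired.
\<close>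

lemma average_prediction_error_le:
  fixes \<delta> C K :: real
  assumes n: "n \<ge> 1" and \<delta>: "0 < \<delta>" "\<delta> \<le> 1" and K: "0 \<le> K"
    and nonneg: "\<And>i. 0 \<le> a i" "\<And>i. 0 \<le> b i" "\<And>i. 0 \<le> e i"
    and F: "F \<le> \<delta>" and G: "0 \<le> G" "G \<le> \<delta>"
    and a: "average n (\<lambda>i. a i ^ 2) \<le> \<delta>\<^sup>2" and b: "average n (\<lambda>i. b i ^ 2) \<le> \<delta>\<^sup>2"
    and q: "average n (\<lambda>i. q i ^ 4) \<le> C" and e: "average n (\<lambda>i. e i ^ 4) \<le> C"
    and r: "average n (\<lambda>i. r i ^ 2) \<le> C"
    and p: "\<And>i. i \<in> {1..n} \<Longrightarrow>
      p i \<le> F + G * e i + (G + K) * (a i * b i + a i * q i * e i + r i * b i)"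
  shows "average n p \<le> \<delta> * (2 + C + (1 + K) * (2 + C))"
proof -
  have "p i \<le> 2 * \<delta> + \<delta> * e i ^ 4 + (1 + K) * ((a i ^ 2 + b i ^ 2) / 2 + (a i ^ 2 + b i ^ 2) / (2 * \<delta>)
      + \<delta> * ((q i ^ 4 + e i ^ 4) / 4 + r i ^ 2 / 2))" (is "_ \<le> ?rhs i") if i: "i \<in> {1..n}" for i
  proof -
    let ?d = "a i * b i + a i * q i * e i + r i * b i"
    let ?y = "(a i ^ 2 + b i ^ 2) / 2 + (a i ^ 2 + b i ^ 2) / (2 * \<delta>)
      + \<delta> * ((q i ^ 4 + e i ^ 4) / 4 + r i ^ 2 / 2)"
    have "?d \<le> ?y" using residual_error_young[OF \<delta>(1) nonneg(1,2)] .
    then have "(G + K) * ?d \<le> (G + K) * ?y"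
      by (rule mult_left_mono) (use G K in simp)
    also have "\<dots> \<le> (1 + K) * ?y"
      using \<delta> G by (intro mult_right_mono add_nonneg_nonneg mult_nonneg_nonneg) auto
    finally have "(G + K) * ?d \<le> (1 + K) * ?y" .
    \<comment> \<open>The first moment of the errors is controlled by the fourth.\<close>
    moreover have "e i \<le> 1 + e i ^ 4"
    proof (cases "e i \<le> 1")
      case False
      then have "e i ^ 1 \<le> e i ^ 4" by (intro power_increasing) auto
      then show ?thesis by simp
    qed (use zero_le_power[OF nonneg(3)[of i], of 4] in linarith)
    then have "G * e i \<le> \<delta> * (1 + e i ^ 4)"
      using G nonneg(3)[of i] \<delta>(1) by (intro mult_mono) auto
    ultimately show ?thesis
      using p[OF i] F by (simp add: distrib_left)
  qed
  then have "average n p \<le> average n ?rhs"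
    by (rule average_mono)
  also have "average n ?rhs =
      2 * \<delta> + \<delta> * average n (\<lambda>i. e i ^ 4) +
      (1 + K) * ((average n (\<lambda>i. a i ^ 2) + average n (\<lambda>i. b i ^ 2)) / 2
        + (average n (\<lambda>i. a i ^ 2) + average n (\<lambda>i. b i ^ 2)) / (2 * \<delta>)
        + \<delta> * ((average n (\<lambda>i. q i ^ 4) + average n (\<lambda>i. e i ^ 4)) / 4 + average n (\<lambda>i. r i ^ 2) / 2))"
    unfolding average_add average_cmult average_divide average_const[OF n] ..
  also have "\<dots> \<le> 2 * \<delta> + \<delta> * C +
      (1 + K) * ((\<delta>\<^sup>2 + \<delta>\<^sup>2) / 2 + (\<delta>\<^sup>2 + \<delta>\<^sup>2) / (2 * \<delta>) + \<delta> * ((C + C) / 4 + C / 2))"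
    using \<delta> K by (intro add_mono mult_left_mono divide_right_mono a b q e r order_refl) auto
  also have "\<dots> = \<delta> * (2 + C) + (1 + K) * (\<delta> * (\<delta> + 1 + C))"
    using \<delta>(1) by (simp add: field_simps power2_eq_square)
  also have "\<dots> \<le> \<delta> * (2 + C) + (1 + K) * (\<delta> * (2 + C))"
    using \<delta> K by (intro add_mono mult_left_mono order_refl) auto
  finally show ?thesis by (simp add: algebra_simps)
qed

section \<open>Comparison of the two sample average objectives\<close>

lemma closed_measure_support: 
  assumes "sets \<mu> = sets borel"
  shows "closed (measure_support \<mu>)"
proof -
  have "- measure_support \<mu> = \<Union>{U. open U \<and> emeasure \<mu> U = 0}"
    by (auto simp: measure_support_def zero_less_iff_neq_zero)
  then show ?thesis unfolding closed_def by auto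
qed

text \<open>
  A true scenario lies in \<open>C\<close> and is its own projection, so nonexpansiveness of the projection
  removes \<open>closest_point\<close> from the estimate. The bound does not depend on \<open>z\<close> except through
  the Lipschitz constant \<open>l\<close>.
\<close>

lemma er_saa_obj_near_full_saa_obj:
  fixes C :: "(real^'dy) set"
  assumes C: "closed C" "convex C" "C \<noteq> {}"
    and lip: "\<And>y y'. y \<in> C \<Longrightarrow> y' \<in> C \<Longrightarrow> \<bar>c z y' - c z y\<bar> \<le> l * norm (y' - y)" and l: "0 \<le> l"
    and inC: "\<And>i. i \<in> {1..n} \<Longrightarrow> f x + Q x *v residual f Q (D i) \<in> C"
  shows "\<bar>er_saa_obj c C fh Qh n D x z - full_saa_obj c f Q n D x z\<bar> \<le>
    l * average n (\<lambda>i. norm ((fh n D x + Qh n D x *v residual (fh n D) (Qh n D) (D i)) -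
                             (f x + Q x *v residual f Q (D i))))"
proof -
  let ?p = "\<lambda>i. fh n D x + Qh n D x *v residual (fh n D) (Qh n D) (D i)"
  let ?t = "\<lambda>i. f x + Q x *v residual f Q (D i)"
  have "\<bar>c z (closest_point C (?p i)) - c z (?t i)\<bar> \<le> l * norm (?p i - ?t i)" if i: "i \<in> {1..n}" for i
  proof -
    have "\<bar>c z (closest_point C (?p i)) - c z (?t i)\<bar> \<le> l * norm (closest_point C (?p i) - ?t i)"
      by (intro lip inC[OF i] closest_point_in_set C)
    also have "norm (closest_point C (?p i) - ?t i) \<le> norm (?p i - ?t i)"
      using closest_point_lipschitz[OF C(2,1,3), of "?p i" "?t i"] closest_point_self[OF inC[OF i]]
      by (simp add: dist_norm)
    finally show ?thesis using l by (simp add: mult_left_mono)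
  qed
  then have "\<bar>\<Sum>i=1..n. c z (closest_point C (?p i)) - c z (?t i)\<bar> \<le> (\<Sum>i=1..n. l * norm (?p i - ?t i))"
    by (intro order_trans[OF sum_abs] sum_mono)
  then have "(1 / real n) * \<bar>\<Sum>i=1..n. c z (closest_point C (?p i)) - c z (?t i)\<bar> \<le>
      average n (\<lambda>i. l * norm (?p i - ?t i))"
    by (rule mult_left_mono) simp
  moreover have "er_saa_obj c C fh Qh n D x z - full_saa_obj c f Q n D x z =
      (1 / real n) * (\<Sum>i=1..n. c z (closest_point C (?p i)) - c z (?t i))"
    by (simp only: er_saa_obj_def full_saa_obj_def sum_subtractf right_diff_distrib)
  ultimately show ?thesis
    by (simp only: abs_mult average_cmult) simp
qed

theorem theorem5:
  fixes N :: "'v measure" and M :: "'w measure"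
    and X :: "'v \<Rightarrow> real^'dx" and Y \<epsilon> :: "'v \<Rightarrow> real^'dy"
    and P\<^sub>X :: "(real^'dx) measure"
    and \<X> :: "(real^'dx) set" and \<Y> :: "(real^'dy) set" and \<Z> :: "(real^'dz) set"
    and f :: "real^'dx \<Rightarrow> real^'dy" and Q :: "real^'dx \<Rightarrow> real^'dy^'dy"
    and c :: "real^'dz \<Rightarrow> real^'dy \<Rightarrow> real" and L :: "real^'dz \<Rightarrow> real"
    and xs :: "nat \<Rightarrow> 'w \<Rightarrow> real^'dx" and ys :: "nat \<Rightarrow> 'w \<Rightarrow> real^'dy"
    and D :: "nat \<Rightarrow> 'w \<Rightarrow> ('dy, 'dx) dataset"
    and fh :: "nat \<Rightarrow> ('dy, 'dx) dataset \<Rightarrow> real^'dx \<Rightarrow> real^'dy"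
    and Qh :: "nat \<Rightarrow> ('dy, 'dx) dataset \<Rightarrow> real^'dx \<Rightarrow> real^'dy^'dy"
    and g :: "real^'dx \<Rightarrow> real^'dz \<Rightarrow> real"
    and gfull ger :: "nat \<Rightarrow> 'w \<Rightarrow> real^'dx \<Rightarrow> real^'dz \<Rightarrow> real"
    (* notation: objective functions and data sets *)
  assumes D_def: "D = sample ys xs"
    and g_def: "g = true_obj N \<epsilon> c f Q"
    and gfull_def: "gfull = (\<lambda>n \<omega>. full_saa_obj c f Q n (D n \<omega>))"
    and ger_def: "ger = (\<lambda>n \<omega>. er_saa_obj c \<Y> fh Qh n (D n \<omega>))"
    (* the model *)
    and N: "prob_space N"
    and X: "X \<in> borel_measurable N" and Y: "Y \<in> borel_measurable N"
    and eps: "\<epsilon> \<in> borel_measurable N"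
    and PX: "P\<^sub>X = distr N borel X" and XX: "\<X> = measure_support P\<^sub>X"
    and YY: "\<Y> = measure_support (distr N borel Y)" "\<Y> \<noteq> {}" "convex \<Y>"
    and ZZ: "\<Z> \<noteq> {}" "compact \<Z>"
    and f_meas: "f \<in> borel_measurable (restrict_space borel \<X>)"
    and Q_meas: "Q \<in> borel_measurable (restrict_space borel \<X>)"
    and c_meas: "(\<lambda>(z, y). c z y) \<in> borel_measurable (restrict_space borel (\<Z> \<times> \<Y>))"
    and Y_model: "AE \<omega> in N. Y \<omega> = f (X \<omega>) + Q (X \<omega>) *v \<epsilon> \<omega>"
    and f_regr: "\<And>j. AE \<omega> in N.
        real_cond_exp N (vimage_algebra (space N) X borel) (\<lambda>\<omega>. Y \<omega> $ j) \<omega> = f (X \<omega>) $ j"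
    and Q_pd: "\<forall>x\<in>\<X>. pos_definite (Q x)"
    and eps_mean: "integrable N \<epsilon>" "(\<integral>\<omega>. \<epsilon> \<omega> \<partial>N) = 0"
    and eps_indep: "prob_space.indep_set N
        (sets (vimage_algebra (space N) X borel)) (sets (vimage_algebra (space N) \<epsilon> borel))"
    and c_int: "\<forall>z\<in>\<Z>. AE x\<in>\<X> in P\<^sub>X. integrable N (\<lambda>\<omega>. c z (f x + Q x *v \<epsilon> \<omega>))"
    and g_lsc: "AE x\<in>\<X> in P\<^sub>X. lsc_on \<Z> (g x)"
    (* data and estimators *)
    and M: "prob_space M"
    and xs: "\<And>i. i \<ge> 1 \<Longrightarrow> xs i \<in> borel_measurable M"
            "\<And>i. i \<ge> 1 \<Longrightarrow> AE \<omega> in M. xs i \<omega> \<in> \<X>"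
    and ys: "\<And>i. i \<ge> 1 \<Longrightarrow> ys i \<in> borel_measurable M"
            "\<And>i. i \<ge> 1 \<Longrightarrow> AE \<omega> in M. ys i \<omega> \<in> \<Y>"
    and in_Y: "AE x\<in>\<X> in P\<^sub>X. \<forall>i\<ge>1. AE \<omega> in M.
        f x + Q x *v residual f Q (ys i \<omega>, xs i \<omega>) \<in> \<Y>"
    and fh_meas: "\<And>n. (\<lambda>(d, x). fh n d x) \<in>
        borel_measurable (Pi\<^sub>M {1..n} (\<lambda>_. borel) \<Otimes>\<^sub>M restrict_space borel \<X>)"
    and Qh_meas: "\<And>n. (\<lambda>(d, x). Qh n d x) \<in>
        borel_measurable (Pi\<^sub>M {1..n} (\<lambda>_. borel) \<Otimes>\<^sub>M restrict_space borel \<X>)"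
    and Qh_inv: "\<forall>n\<ge>1. AE \<omega> in M. \<forall>x\<in>\<X>. invertible (Qh n (D n \<omega>) x)"
    and er_sol: "AE x\<in>\<X> in P\<^sub>X. \<forall>n\<ge>1. AE \<omega> in M. opt_set \<Z> (ger n \<omega> x) \<noteq> {}"
    (* measurability of the random quantities in the conclusion *)
    and er_meas: "AE x\<in>\<X> in P\<^sub>X. \<forall>n.
        (\<lambda>\<omega>. opt_value \<Z> (ger n \<omega> x)) \<in> borel_measurable M \<and>
        (\<lambda>\<omega>. set_deviation (opt_set \<Z> (ger n \<omega> x)) (opt_set \<Z> (g x))) \<in> borel_measurable M \<and>
        (\<lambda>\<omega>. SUP z\<in>opt_set \<Z> (ger n \<omega> x). ereal (g x z)) \<in> borel_measurable M"
    (* the numbered assumptions *)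
    and A1: "\<forall>z\<in>\<Z>. \<forall>y\<in>\<Y>. \<forall>y'\<in>\<Y>. \<bar>c z y' - c z y\<bar> \<le> L z * norm (y' - y)"
            "bdd_above (L ` \<Z>)"
    and A2: "AE x\<in>\<X> in P\<^sub>X.
        tendsto_prob_ereal M (\<lambda>n \<omega>. SUP z\<in>\<Z>. ereal \<bar>gfull n \<omega> x z - g x z\<bar>) 0"
    and A3: "integrable N (\<lambda>\<omega>. mat_norm (Q (X \<omega>)) ^ 4)"
            "tendsto_prob M (\<lambda>n \<omega>. (1 / real n) * (\<Sum>i=1..n. mat_norm (Q (xs i \<omega>)) ^ 4))
               (\<integral>\<omega>. mat_norm (Q (X \<omega>)) ^ 4 \<partial>N)"
            "integrable N (\<lambda>\<omega>. mat_norm (matrix_inv (Q (X \<omega>))) ^ 2)"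
            "tendsto_prob M
               (\<lambda>n \<omega>. (1 / real n) * (\<Sum>i=1..n. mat_norm (matrix_inv (Q (xs i \<omega>))) ^ 2))
               (\<integral>\<omega>. mat_norm (matrix_inv (Q (X \<omega>))) ^ 2 \<partial>N)"
    and A4: "integrable N (\<lambda>\<omega>. norm (\<epsilon> \<omega>) ^ 4)"
            "tendsto_prob M
               (\<lambda>n \<omega>. (1 / real n) * (\<Sum>i=1..n. norm (residual f Q (ys i \<omega>, xs i \<omega>)) ^ 4))
               (\<integral>\<omega>. norm (\<epsilon> \<omega>) ^ 4 \<partial>N)"
    and A5a: "AE x\<in>\<X> in P\<^sub>X. tendsto_prob M (\<lambda>n \<omega>. fh n (D n \<omega>) x) (f x)"
    and A5b: "tendsto_prob M
        (\<lambda>n \<omega>. (1 / real n) * (\<Sum>i=1..n. norm (f (xs i \<omega>) - fh n (D n \<omega>) (xs i \<omega>)) ^ 2)) 0"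
    and A5c: "AE x\<in>\<X> in P\<^sub>X.
        tendsto_prob M (\<lambda>n \<omega>. mat_norm (Qh n (D n \<omega>) x - Q x)) 0"
    and A5d: "tendsto_prob M
        (\<lambda>n \<omega>. (1 / real n) * (\<Sum>i=1..n.
           mat_norm (matrix_inv (Qh n (D n \<omega>) (xs i \<omega>)) - matrix_inv (Q (xs i \<omega>))) ^ 2)) 0"
  shows "AE x\<in>\<X> in P\<^sub>X.
      tendsto_prob M (\<lambda>n \<omega>. opt_value \<Z> (ger n \<omega> x)) (opt_value \<Z> (g x)) \<and>
      tendsto_prob_ereal M
        (\<lambda>n \<omega>. set_deviation (opt_set \<Z> (ger n \<omega> x)) (opt_set \<Z> (g x))) 0 \<and>
      tendsto_prob_ereal M
        (\<lambda>n \<omega>. SUP z\<in>opt_set \<Z> (ger n \<omega> x). ereal (g x z)) (opt_value \<Z> (g x))"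
proof -
  have "closed \<Y>"
    unfolding YY(1) by (intro closed_measure_support) simp
  obtain l where l: "0 \<le> l" "\<And>z. z \<in> \<Z> \<Longrightarrow> L z \<le> l"
    using A1(2) unfolding bdd_above_def by (metis image_eqI linorder_linear order_trans)
  have lip: "\<bar>c z y' - c z y\<bar> \<le> l * norm (y' - y)" if "z \<in> \<Z>" "y \<in> \<Y>" "y' \<in> \<Y>" for z y y'
    using A1(1) that mult_right_mono[OF l(2)[OF that(1)] norm_ge_zero[of "y' - y"]]
    by (meson order_trans)
  have D: "D n \<omega> i = (ys i \<omega>, xs i \<omega>)" if "i \<in> {1..n}" for n \<omega> i
    using that by (simp add: D_def sample_def)

  define a where "a n \<omega> i =
    mat_norm (matrix_inv (Qh n (D n \<omega>) (xs i \<omega>)) - matrix_inv (Q (xs i \<omega>)))" for n \<omega> i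
  define b where "b n \<omega> i = norm (f (xs i \<omega>) - fh n (D n \<omega>) (xs i \<omega>))" for n \<omega> i
  define q where "q \<omega> i = mat_norm (Q (xs i \<omega>))" for \<omega> i
  define r where "r \<omega> i = mat_norm (matrix_inv (Q (xs i \<omega>)))" for \<omega> i
  define e where "e \<omega> i = norm (residual f Q (ys i \<omega>, xs i \<omega>))" for \<omega> i
  \<comment> \<open>One constant that eventually dominates all three empirical moments; the limits are
    nonnegative, so their sum dominates each of them, and 1 allows for the fluctuation.\<close>
  define C where "C = 1 + (\<integral>\<omega>. mat_norm (Q (X \<omega>)) ^ 4 \<partial>N) +
    (\<integral>\<omega>. mat_norm (matrix_inv (Q (X \<omega>))) ^ 2 \<partial>N) + (\<integral>\<omega>. norm (\<epsilon> \<omega>) ^ 4 \<partial>N)"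
  have int0: "0 \<le> (\<integral>\<omega>. mat_norm (Q (X \<omega>)) ^ 4 \<partial>N)"
    "0 \<le> (\<integral>\<omega>. mat_norm (matrix_inv (Q (X \<omega>))) ^ 2 \<partial>N)" "0 \<le> (\<integral>\<omega>. norm (\<epsilon> \<omega>) ^ 4 \<partial>N)"
    by (auto intro!: integral_nonneg_AE simp: mat_norm_nonneg)

  have near: "whp M (\<lambda>n \<omega>. dist (V n \<omega>) v \<le> d)" if "tendsto_prob M V v" "0 < d"
    for V :: "nat \<Rightarrow> 'w \<Rightarrow> 'b::{metric_space, second_countable_topology}" and v d
    using that tendsto_prob_iff_whp[OF M] by blast

  have near_ereal: "whp M (\<lambda>n \<omega>. \<bar>V n \<omega> - ereal v\<bar> \<le> ereal d)"
    if "tendsto_prob_ereal M V v" "0 < d" for V v d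
    using that tendsto_prob_ereal_iff_whp[OF M] by blast

  have moments: "whp M (\<lambda>n \<omega>. average n (\<lambda>i. q \<omega> i ^ 4) \<le> C \<and> average n (\<lambda>i. r \<omega> i ^ 2) \<le> C \<and>
      average n (\<lambda>i. e \<omega> i ^ 4) \<le> C)"
    by (rule whp_mono[OF whp_conj[OF M near[OF A3(2) zero_less_one]
          whp_conj[OF M near[OF A3(4) zero_less_one] near[OF A4(2) zero_less_one]]]],
        intro always_eventually allI AE_I2 impI conjI;
        unfold C_def q_def r_def e_def dist_real_def abs_le_iff; use int0 in linarith)
  have errors: "whp M (\<lambda>n \<omega>. average n (\<lambda>i. a n \<omega> i ^ 2) \<le> d \<and> average n (\<lambda>i. b n \<omega> i ^ 2) \<le> d)"
    if "0 < d" for d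
    by (rule whp_mono[OF whp_conj[OF M near[OF A5d that] near[OF A5b that]]],
        intro always_eventually allI AE_I2 impI conjI;
        unfold a_def b_def dist_real_def abs_le_iff; linarith)

  show ?thesis
    using g_lsc in_Y er_sol er_meas A2 A5a A5c
  proof eventually_elim
    case (elim x)
    show ?case
    proof (intro impI)
      assume x: "x \<in> \<X>"
      note x_props = elim[THEN mp, OF x]

      have ger_near_gfull: "whp M (\<lambda>n \<omega>. \<forall>z\<in>\<Z>. \<bar>ger n \<omega> x z - gfull n \<omega> x z\<bar> \<le> d)" if d: "0 < d" for d
      proof -
        let ?K = "mat_norm (Q x)"
        define k where "k = l * (2 + C + (1 + ?K) * (2 + C))"
        have "0 \<le> k"
          unfolding k_def C_def using l(1) int0 mat_norm_nonneg[of "Q x"]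
          by (intro mult_nonneg_nonneg add_nonneg_nonneg) auto
        \<comment> \<open>The gap between the objectives will be at most \<open>\<delta> * k\<close>; adding 1 to
          \<open>k\<close> keeps the quotient meaningful when \<open>k = 0\<close>.\<close>
        define \<delta> where "\<delta> = min 1 (d / (k + 1))"
        have \<delta>: "0 < \<delta>" "\<delta> \<le> 1" using \<open>0 \<le> k\<close> d by (auto simp: \<delta>_def)
        have "\<delta> * k \<le> d / (k + 1) * k"
          unfolding \<delta>_def using \<open>0 \<le> k\<close> by (intro mult_right_mono) auto
        also have "\<dots> \<le> d"
          using \<open>0 \<le> k\<close> d by (simp add: field_simps)
        finally have \<delta>k: "\<delta> * k \<le> d" .
        have "\<forall>\<^sub>F n in sequentially. AE \<omega> in M. \<forall>i\<in>{1..n}.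
            xs i \<omega> \<in> \<X> \<and> f x + Q x *v residual f Q (ys i \<omega>, xs i \<omega>) \<in> \<Y>"
        proof (rule always_eventually, rule allI, rule AE_finite_allI)
          fix n i :: nat assume "i \<in> {1..n}"
          then have "AE \<omega> in M. xs i \<omega> \<in> \<X>"
            "AE \<omega> in M. f x + Q x *v residual f Q (ys i \<omega>, xs i \<omega>) \<in> \<Y>"
            using xs(2) x_props(2) by auto
          then show "AE \<omega> in M. xs i \<omega> \<in> \<X> \<and> f x + Q x *v residual f Q (ys i \<omega>, xs i \<omega>) \<in> \<Y>"
            by (rule AE_conjI)
        qed simp
        then have "whp M (\<lambda>n \<omega>. \<forall>i\<in>{1..n}.
            xs i \<omega> \<in> \<X> \<and> f x + Q x *v residual f Q (ys i \<omega>, xs i \<omega>) \<in> \<Y>)"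
          by (rule whp_if_eventually_AE)
        note all = whp_conj[OF M this whp_conj[OF M moments whp_conj[OF M
              errors[OF zero_less_power[OF \<delta>(1), of 2]]
              whp_conj[OF M near[OF x_props(6) \<delta>(1)] near[OF x_props(7) \<delta>(1)]]]]]
        show ?thesis
        proof (rule whp_mono[OF all], rule eventually_mono[OF eventually_ge_at_top[of 1]],
            intro AE_I2 impI ballI, elim conjE)
          fix n \<omega> z
          assume n: "1 \<le> n" and z: "z \<in> \<Z>"
            and good: "\<forall>i\<in>{1..n}. xs i \<omega> \<in> \<X> \<and> f x + Q x *v residual f Q (ys i \<omega>, xs i \<omega>) \<in> \<Y>"
            and q: "average n (\<lambda>i. q \<omega> i ^ 4) \<le> C" and r: "average n (\<lambda>i. r \<omega> i ^ 2) \<le> C"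
            and e: "average n (\<lambda>i. e \<omega> i ^ 4) \<le> C"
            and a: "average n (\<lambda>i. a n \<omega> i ^ 2) \<le> \<delta>\<^sup>2" and b: "average n (\<lambda>i. b n \<omega> i ^ 2) \<le> \<delta>\<^sup>2"
            and F: "dist (fh n (D n \<omega>) x) (f x) \<le> \<delta>"
            and G: "dist (mat_norm (Qh n (D n \<omega>) x - Q x)) 0 \<le> \<delta>"
          let ?p = "\<lambda>i. norm ((fh n (D n \<omega>) x +
              Qh n (D n \<omega>) x *v residual (fh n (D n \<omega>)) (Qh n (D n \<omega>)) (D n \<omega> i)) -
              (f x + Q x *v residual f Q (D n \<omega> i)))"
          have "average n ?p \<le> \<delta> * (2 + C + (1 + ?K) * (2 + C))"
          proof (rule average_prediction_error_le[OF n \<delta> mat_norm_nonneg _ _ _ _ mat_norm_nonneg _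
                a b q e r])
            fix i assume i: "i \<in> {1..n}"
            have "pos_definite (Q (xs i \<omega>))" using good i Q_pd by auto
            from residual_error_le[of Q, OF this, of "fh n (D n \<omega>)" "Qh n (D n \<omega>)" "ys i \<omega>" f]
            have "norm (residual (fh n (D n \<omega>)) (Qh n (D n \<omega>)) (D n \<omega> i) - residual f Q (D n \<omega> i)) \<le>
                a n \<omega> i * b n \<omega> i + a n \<omega> i * q \<omega> i * e \<omega> i + r \<omega> i * b n \<omega> i"
              unfolding D[OF i] a_def b_def q_def e_def r_def .
            from mult_left_mono[OF this, of "mat_norm (Qh n (D n \<omega>) x - Q x) + ?K"]
            show "?p i \<le> norm (fh n (D n \<omega>) x - f x) + mat_norm (Qh n (D n \<omega>) x - Q x) * e \<omega> i +
                (mat_norm (Qh n (D n \<omega>) x - Q x) + ?K) *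
                (a n \<omega> i * b n \<omega> i + a n \<omega> i * q \<omega> i * e \<omega> i + r \<omega> i * b n \<omega> i)"
              using prediction_error_le[of "fh n (D n \<omega>) x" "Qh n (D n \<omega>) x"
                  "residual (fh n (D n \<omega>)) (Qh n (D n \<omega>)) (D n \<omega> i)" "f x" "Q x" "residual f Q (D n \<omega> i)"]
              by (simp add: D[OF i] e_def mat_norm_nonneg)
          qed (use F G in \<open>auto simp: dist_norm a_def b_def e_def mat_norm_nonneg\<close>)
          from mult_left_mono[OF this l(1)]
          have "l * average n ?p \<le> d" using \<delta>k by (simp add: k_def mult_ac)
          moreover have "\<bar>ger n \<omega> x z - gfull n \<omega> x z\<bar> \<le> l * average n ?p"
            unfolding ger_def gfull_def
            by (rule er_saa_obj_near_full_saa_obj[OF \<open>closed \<Y>\<close> YY(3,2) _ l(1)])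
              (use lip[OF z] good D in auto)
          ultimately show "\<bar>ger n \<omega> x z - gfull n \<omega> x z\<bar> \<le> d" by simp
        qed
      qed

      have ger_near_g: "whp M (\<lambda>n \<omega>. \<forall>z\<in>\<Z>. \<bar>ger n \<omega> x z - g x z\<bar> \<le> d)" if d: "0 < d" for d
      proof -
        have "whp M (\<lambda>n \<omega>. \<bar>(SUP z\<in>\<Z>. ereal \<bar>gfull n \<omega> x z - g x z\<bar>) - ereal 0\<bar> \<le> ereal (d / 2))"
          by (rule near_ereal[OF x_props(5) half_gt_zero[OF d]])
        from whp_conj[OF M this ger_near_gfull[OF half_gt_zero[OF d]]] show ?thesis
        proof (rule whp_mono, intro always_eventually allI AE_I2 impI ballI, elim conjE)
          fix n \<omega> z
          assume z: "z \<in> \<Z>"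
            and sup: "\<bar>(SUP z\<in>\<Z>. ereal \<bar>gfull n \<omega> x z - g x z\<bar>) - ereal 0\<bar> \<le> ereal (d / 2)"
            and ger: "\<forall>z\<in>\<Z>. \<bar>ger n \<omega> x z - gfull n \<omega> x z\<bar> \<le> d / 2"
          have "ereal \<bar>gfull n \<omega> x z - g x z\<bar> \<le> (SUP z\<in>\<Z>. ereal \<bar>gfull n \<omega> x z - g x z\<bar>)"
            using z by (rule SUP_upper)
          also have "\<dots> \<le> ereal (d / 2)"
            using ereal_le_if_abs_diff_le[OF sup] by simp
          finally have "\<bar>gfull n \<omega> x z - g x z\<bar> \<le> d / 2" by simp
          moreover have "\<bar>ger n \<omega> x z - gfull n \<omega> x z\<bar> \<le> d / 2" using ger z by blast
          ultimately show "\<bar>ger n \<omega> x z - g x z\<bar> \<le> d" by linarith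
        qed
      qed

      have "\<forall>\<^sub>F n in sequentially. AE \<omega> in M. opt_set \<Z> (ger n \<omega> x) \<noteq> {}"
        using x_props(3) by (intro eventually_mono[OF eventually_ge_at_top[of 1]]) auto
      then have solvable: "whp M (\<lambda>n \<omega>. opt_set \<Z> (ger n \<omega> x) \<noteq> {})"
        by (rule whp_if_eventually_AE)

      have all_near: "whp M (\<lambda>n \<omega>.
          dist (opt_value \<Z> (ger n \<omega> x)) (opt_value \<Z> (g x)) \<le> d \<and>
          \<bar>set_deviation (opt_set \<Z> (ger n \<omega> x)) (opt_set \<Z> (g x)) - ereal 0\<bar> \<le> ereal d \<and>
          \<bar>(SUP z\<in>opt_set \<Z> (ger n \<omega> x). ereal (g x z)) - ereal (opt_value \<Z> (g x))\<bar> \<le> ereal d)"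
        (is "whp M (?near d)") if d: "0 < d" for d
      proof -
        obtain \<delta> where "0 < \<delta>" and stable:
          "\<And>n \<omega>. (\<And>z. z \<in> \<Z> \<Longrightarrow> \<bar>ger n \<omega> x z - g x z\<bar> \<le> \<delta>) \<Longrightarrow> opt_set \<Z> (ger n \<omega> x) \<noteq> {} \<Longrightarrow>
            ?near d n \<omega>"
          using minimization_stable[OF ZZ(2,1) x_props(1) d] by metis
        show ?thesis
          by (rule whp_mono[OF whp_conj[OF M ger_near_g[OF \<open>0 < \<delta>\<close>] solvable]],
              intro always_eventually allI AE_I2 impI stable) auto
      qed

      show "tendsto_prob M (\<lambda>n \<omega>. opt_value \<Z> (ger n \<omega> x)) (opt_value \<Z> (g x)) \<and>
        tendsto_prob_ereal M
          (\<lambda>n \<omega>. set_deviation (opt_set \<Z> (ger n \<omega> x)) (opt_set \<Z> (g x))) 0 \<and>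
        tendsto_prob_ereal M
          (\<lambda>n \<omega>. SUP z\<in>opt_set \<Z> (ger n \<omega> x). ereal (g x z)) (opt_value \<Z> (g x))"
        unfolding tendsto_prob_iff_whp[OF M] tendsto_prob_ereal_iff_whp[OF M]
        using x_props(4) by (auto intro: whp_mono[OF all_near])
    qed
  qed
qed

end
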